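(* Let $P$ be a finite graded poset with unique minimum $\hat 0$ and unique maximum $\hat 1$. Let $(A,\le^\circ)$ be a partially ordered set whose elements are atoms of $P$, let $a^+$ be an atom of $P$ not in $A$, let $A^+=A\cup\{a^+\}$ with the partial order extending $\le^\circ$ on $A$ in which $a^+\ge^\circ a$ for all $a\in A$, and let $Q=P\langle A^+\rangle\setminus P\langle A\rangle$. Suppose: (i) $P\langle A\rangle$ is $A$-shellable; (ii) there is a linear order on $A^{all}(a^+)$ in which the elements of $A(a^+)$ appear before all other elements, such that $I(a^+)=I(a^+)\langle A^{all}(a^+)\rangle$ is $A^{all}(a^+)$-shellable with respect to this order; and (iii) for every $q\in Q$ and every $p\in P\langle A\rangle$ with $p\gtrdot q$, we have $p\in I(a^+)\langle A(a^+)\rangle$. Then $P\langle A^+\rangle$ is $A^+$-shellable.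
   Context: An atom of a poset with minimum $\hat 0$ is an element covering $\hat 0$; $x\gtrdot y$ means $x$ covers $y$. For a set $B$ of atoms of a poset $R$ with minimum $\hat 0_R$, $R\langle B\rangle$ is the induced subposet on $\{\hat 0_R\}\cup\{b\in R: b\ge a\text{ for some }a\in B\}$. A maximal-chain order of a bounded poset is a shelling order if whenever $c'$ precedes $c$ there is $c^*$ preceding $c$ with $c\cap c^*\supseteq c\cap c'$ and $|c\,\Delta\, c^*|=2$; shellable means such an order exists. For a partially ordered set $(B,\le^\circ)$ of atoms, $R\langle B\rangle$ is $B$-shellable if it has a shelling order in which a maximal chain $c'$ precedes $c$ whenever the atom of $c'$ is strictly $\le^\circ$-smaller than the atom of $c$. $I(a^+)=[a^+,\hat 1]$; $A^{all}(a^+)$ is the set of all atoms of $I(a^+)$ (elements of $P$ covering $a^+$), and $A(a^+)$ is the set of those atoms of $I(a^+)$ which belong to $P\langle A\rangle$. *)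

theory Defs
  imports Main
begin

text \<open>
  A poset is a carrier set together with an order relation in the sense of
  \<^const>\<open>partial_order_on\<close>. The functions below take a carrier \<open>S\<close> and the order
  relation \<open>r\<close> of an ambient poset containing it, so that \<open>S\<close> stands for the
  induced subposet on \<open>S\<close>.
\<close>

definition is_minimum :: "'a set \<Rightarrow> 'a rel \<Rightarrow> 'a \<Rightarrow> bool" where
  "is_minimum S r z \<longleftrightarrow> z \<in> S \<and> (\<forall>x\<in>S. (z, x) \<in> r)"

definition is_maximum :: "'a set \<Rightarrow> 'a rel \<Rightarrow> 'a \<Rightarrow> bool" where
  "is_maximum S r u \<longleftrightarrow> u \<in> S \<and> (\<forall>x\<in>S. (x, u) \<in> r)"

text \<open>\<open>covers S r x y\<close>: the upper element is \<open>x\<close>, i.e. \<open>x\<close> covers \<open>y\<close> in \<open>S\<close>.\<close>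

definition covers :: "'a set \<Rightarrow> 'a rel \<Rightarrow> 'a \<Rightarrow> 'a \<Rightarrow> bool" where
  "covers S r x y \<longleftrightarrow> x \<in> S \<and> y \<in> S \<and> (y, x) \<in> r \<and> y \<noteq> x \<and>
     \<not> (\<exists>w\<in>S. (y, w) \<in> r \<and> (w, x) \<in> r \<and> w \<noteq> y \<and> w \<noteq> x)"

definition atoms :: "'a set \<Rightarrow> 'a rel \<Rightarrow> 'a \<Rightarrow> 'a set" where
  "atoms S r z = {x. covers S r x z}"

definition interval :: "'a set \<Rightarrow> 'a rel \<Rightarrow> 'a \<Rightarrow> 'a \<Rightarrow> 'a set" where
  "interval S r x y = {w \<in> S. (x, w) \<in> r \<and> (w, y) \<in> r}"

definition max_chains :: "'a set \<Rightarrow> 'a rel \<Rightarrow> 'a set set" where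
  "max_chains S r = {C. pred_on.maxchain S (\<lambda>x y. (x, y) \<in> r) C}"

text \<open>Used for finite \<open>S\<close> only, where \<^const>\<open>card\<close> is the true size of a chain.\<close>

definition graded :: "'a set \<Rightarrow> 'a rel \<Rightarrow> bool" where
  "graded S r \<longleftrightarrow> (\<forall>C\<in>max_chains S r. \<forall>D\<in>max_chains S r. card C = card D)"

text \<open>The carrier of \<open>S\<langle>B\<rangle>\<close>, where \<open>z\<close> is the minimum of \<open>S\<close>.\<close>

definition atom_span :: "'a set \<Rightarrow> 'a rel \<Rightarrow> 'a \<Rightarrow> 'a set \<Rightarrow> 'a set" where
  "atom_span S r z B = {z} \<union> {b \<in> S. \<exists>a\<in>B. (a, b) \<in> r}"

definition strictly_before :: "'b rel \<Rightarrow> 'b \<Rightarrow> 'b \<Rightarrow> bool" where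
  "strictly_before L x y \<longleftrightarrow> (x, y) \<in> L \<and> x \<noteq> y"

definition shelling_order :: "'a set \<Rightarrow> 'a rel \<Rightarrow> 'a set rel \<Rightarrow> bool" where
  "shelling_order S r L \<longleftrightarrow> linear_order_on (max_chains S r) L \<and>
     (\<forall>c\<in>max_chains S r. \<forall>c'\<in>max_chains S r. strictly_before L c' c \<longrightarrow>
        (\<exists>cs\<in>max_chains S r. strictly_before L cs c \<and> c \<inter> c' \<subseteq> c \<inter> cs \<and>
           card (sym_diff c cs) = 2))"

text \<open>
  \<open>B_shellable S r z B s\<close>: for \<open>S\<close> with minimum \<open>z\<close> and a set \<open>B\<close> of atoms of \<open>S\<close>
  partially ordered by \<open>s\<close>, the poset \<open>S\<langle>B\<rangle>\<close> is \<open>B\<close>-shellable. The atom of a maximal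
  chain of \<open>S\<langle>B\<rangle>\<close> is the only atom of \<open>S\<langle>B\<rangle>\<close> lying on it; it is missing only
  if \<open>S\<langle>B\<rangle> = {z}\<close>.
\<close>

definition B_shellable :: "'a set \<Rightarrow> 'a rel \<Rightarrow> 'a \<Rightarrow> 'a set \<Rightarrow> 'a rel \<Rightarrow> bool" where
  "B_shellable S r z B s \<longleftrightarrow>
     (let T = atom_span S r z B in
      \<exists>L. shelling_order T r L \<and>
        (\<forall>c\<in>max_chains T r. \<forall>c'\<in>max_chains T r.
           \<forall>a\<in>c \<inter> atoms T r z. \<forall>a'\<in>c' \<inter> atoms T r z.
             strictly_before s a' a \<longrightarrow> strictly_before L c' c))"

definition adjoin_greatest :: "'a set \<Rightarrow> 'a rel \<Rightarrow> 'a \<Rightarrow> 'a rel" where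
  "adjoin_greatest A s a = s \<union> {(x, a) |x. x \<in> insert a A}"

lemma adjoin_greatest_unique:
  assumes "partial_order_on A s" "a \<notin> A"
  shows "partial_order_on (insert a A) t \<and> Restr t A = s \<and> (\<forall>x\<in>A. (x, a) \<in> t)
           \<longleftrightarrow> t = adjoin_greatest A s a"
proof
  assume t: "partial_order_on (insert a A) t \<and> Restr t A = s \<and> (\<forall>x\<in>A. (x, a) \<in> t)"
  then have "(a, a) \<in> t" and sub: "t \<subseteq> insert a A \<times> insert a A" and "antisym t"
    by (auto simp: order_on_defs refl_on_def)
  moreover have "(a, x) \<notin> t" if "x \<in> A" for x
    using that t assms(2) antisymD[OF \<open>antisym t\<close>, of a x] by blast
  ultimately show "t = adjoin_greatest A s a"
    using t unfolding adjoin_greatest_def by blast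
next
  assume "t = adjoin_greatest A s a"
  moreover have "partial_order_on (insert a A) (adjoin_greatest A s a)"
    using assms unfolding order_on_defs adjoin_greatest_def refl_on_def antisym_def trans_def
    by blast
  ultimately show "partial_order_on (insert a A) t \<and> Restr t A = s \<and> (\<forall>x\<in>A. (x, a) \<in> t)"
    using assms by (auto simp: adjoin_greatest_def order_on_defs)
qed

end

theory Submission
  imports Defs
begin

text \<open>
  A maximal chain of \<open>P\<langle>A\<^sup>+\<rangle>\<close> either avoids \<open>a\<^sup>+\<close> and is a maximal chain of \<open>P\<langle>A\<rangle>\<close>, or it is
  \<open>0\<close> adjoined to a maximal chain of \<open>I(a\<^sup>+)\<close>. List the former in the order from (i), followed by the
  latter in the order from (ii). The only new case is a chain \<open>c\<close> through \<open>a\<^sup>+\<close> preceded by a chain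
  \<open>c'\<close> of \<open>P\<langle>A\<rangle>\<close>. If the element of \<open>c\<close> following \<open>a\<^sup>+\<close> lies in \<open>P\<langle>A\<rangle>\<close>, gradedness allows
  \<open>a\<^sup>+\<close> to be exchanged for an element of \<open>A\<close>. Otherwise let \<open>p\<close> be the least nonzero element of \<open>c\<close>
  in \<open>P\<langle>A\<rangle>\<close>. It covers an element of \<open>Q\<close>, so by (iii) it lies above some atom in \<open>A(a\<^sup>+)\<close>, and
  a maximal chain of \<open>I(a\<^sup>+)\<close> through this atom which agrees with \<open>c\<close> from \<open>p\<close> upwards precedes
  \<open>c\<close>; the shelling order from (ii) then yields the required chain.
\<close>

section \<open>Building linear orders: restriction, transport along an injection, ordinal
  sum\<close>

lemma linear_order_on_Restr:
  assumes "linear_order_on B R" "A \<subseteq> B"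
  shows "linear_order_on A (Restr R A)"
  using assms
  unfolding order_on_defs refl_on_def antisym_def trans_def total_on_def by blast

lemma map_prod_image_iff:
  assumes "inj_on f A" "R \<subseteq> A \<times> A" "x \<in> A" "y \<in> A"
  shows "(f x, f y) \<in> map_prod f f ` R \<longleftrightarrow> (x, y) \<in> R"
proof
  assume "(f x, f y) \<in> map_prod f f ` R"
  then obtain u v where "(u, v) \<in> R" "f x = f u" "f y = f v"
    by auto
  then show "(x, y) \<in> R"
    using assms inj_onD[OF assms(1)] by (metis SigmaD1 SigmaD2 subsetD)
next
  assume "(x, y) \<in> R"
  then show "(f x, f y) \<in> map_prod f f ` R"
    by (metis map_prod_imageI)
qed

lemma linear_order_on_image:
  assumes "linear_order_on A R" "inj_on f A"
  shows "linear_order_on (f ` A) (map_prod f f ` R)"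
proof -
  have R: "R \<subseteq> A \<times> A" "trans R" "antisym R" "total_on A R" "\<And>x. x \<in> A \<Longrightarrow> (x, x) \<in> R"
    using assms(1) by (auto simp: order_on_defs refl_on_def)
  have iff: "(f x, f y) \<in> map_prod f f ` R \<longleftrightarrow> (x, y) \<in> R" if "x \<in> A" "y \<in> A" for x y
    using map_prod_image_iff[OF assms(2) R(1) that] .
  have sub: "map_prod f f ` R \<subseteq> f ` A \<times> f ` A"
    using R(1) by auto
  have "trans (map_prod f f ` R)"
  proof (rule transI)
    fix u v w
    assume uv: "(u, v) \<in> map_prod f f ` R" and vw: "(v, w) \<in> map_prod f f ` R"
    have "u \<in> f ` A" "v \<in> f ` A" "w \<in> f ` A"
      using subsetD[OF sub uv] subsetD[OF sub vw] by auto
    then obtain x y t where "u = f x" "v = f y" "w = f t" "x \<in> A" "y \<in> A" "t \<in> A"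
      by blast
    then show "(u, w) \<in> map_prod f f ` R"
      using uv vw iff R(2) by (metis transD)
  qed
  moreover have "antisym (map_prod f f ` R)"
  proof (rule antisymI)
    fix u v
    assume uv: "(u, v) \<in> map_prod f f ` R" and vu: "(v, u) \<in> map_prod f f ` R"
    have "u \<in> f ` A" "v \<in> f ` A"
      using subsetD[OF sub uv] by auto
    then obtain x y where "u = f x" "v = f y" "x \<in> A" "y \<in> A"
      by blast
    then show "u = v"
      using uv vu iff R(3) by (metis antisymD)
  qed
  moreover have "total_on (f ` A) (map_prod f f ` R)"
    using R(4) iff unfolding total_on_def by (metis imageE)
  moreover have "refl_on (f ` A) (map_prod f f ` R)"
    using R(5) iff unfolding refl_on_def by blast
  ultimately show ?thesis
    using sub unfolding order_on_defs by blast
qed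

text \<open>Serves to list all chains avoiding \<open>ap\<close> ahead of all chains through
  it.\<close>

lemma linear_order_on_ordinal_sum:
  assumes "linear_order_on A R" "linear_order_on B S" "A \<inter> B = {}"
  shows "linear_order_on (A \<union> B) (R \<union> S \<union> A \<times> B)"
proof -
  have 1: "R \<subseteq> A \<times> A" "refl_on A R" "trans R" "antisym R" "total_on A R"
    and 2: "S \<subseteq> B \<times> B" "refl_on B S" "trans S" "antisym S" "total_on B S"
    using assms by (auto simp: order_on_defs)
  have "trans (R \<union> S \<union> A \<times> B)"
    using 1(1,3) 2(1,3) assms(3) unfolding trans_def by blast
  moreover have "antisym (R \<union> S \<union> A \<times> B)"
    using 1(1,4) 2(1,4) assms(3) unfolding antisym_def by blast
  moreover have "total_on (A \<union> B) (R \<union> S \<union> A \<times> B)"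
    using 1(5) 2(5) unfolding total_on_def by blast
  moreover have "refl_on (A \<union> B) (R \<union> S \<union> A \<times> B)"
    using 1(2) 2(2) unfolding refl_on_def by blast
  ultimately show ?thesis
    using 1(1) 2(1) unfolding order_on_defs by blast
qed

section \<open>Extremal elements of finite chains\<close>

lemma finite_chain_has_least:
  assumes "finite C" "C \<noteq> {}" "trans r" "\<And>x y. x \<in> C \<Longrightarrow> y \<in> C \<Longrightarrow> (x, y) \<in> r \<or> (y, x) \<in> r"
  obtains m where "m \<in> C" "\<And>y. y \<in> C \<Longrightarrow> (m, y) \<in> r"
proof -
  have "\<exists>m\<in>C. \<forall>y\<in>C. (m, y) \<in> r"
    using assms
  proof (induction C rule: finite_ne_induct)
    case (singleton x)
    then show ?case by blast
  next
    case (insert x F)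
    then obtain m where m: "m \<in> F" "\<forall>y\<in>F. (m, y) \<in> r"
      by blast
    have "(x, x) \<in> r" "(x, m) \<in> r \<or> (m, x) \<in> r"
      using insert.prems(2) m(1) by blast+
    then show ?case
      using m insert.prems(1) by (metis insertE insertI1 insertI2 transD)
  qed
  then show ?thesis
    using that by blast
qed

lemma finite_chain_has_greatest:
  assumes "finite C" "C \<noteq> {}" "trans r" "\<And>x y. x \<in> C \<Longrightarrow> y \<in> C \<Longrightarrow> (x, y) \<in> r \<or> (y, x) \<in> r"
  obtains m where "m \<in> C" "\<And>y. y \<in> C \<Longrightarrow> (y, m) \<in> r"
proof -
  have "trans (r\<inverse>)" using assms(3) by simp
  then show ?thesis
    using finite_chain_has_least[of C "r\<inverse>"] assms(1,2,4) that by (metis converse_iff)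
qed

section \<open>Maximal chains of induced subposets of a finite poset\<close>

locale finite_poset =
  fixes P :: "'a set" and r :: "'a rel"
  assumes finite_carrier: "finite P"
    and partial_order: "partial_order_on P r"
begin

lemma le_refl: "x \<in> P \<Longrightarrow> (x, x) \<in> r"
  using partial_order by (simp add: order_on_defs refl_on_def)

lemma trans_le: "trans r"
  using partial_order by (simp add: order_on_defs)

lemma le_trans: "(x, y) \<in> r \<Longrightarrow> (y, w) \<in> r \<Longrightarrow> (x, w) \<in> r"
  using trans_le by (rule transD)

lemma le_antisym: "(x, y) \<in> r \<Longrightarrow> (y, x) \<in> r \<Longrightarrow> x = y"
  using partial_order by (auto simp: order_on_defs dest: antisymD)

definition comparable :: "'a \<Rightarrow> 'a \<Rightarrow> bool" where
  "comparable x y \<longleftrightarrow> (x, y) \<in> r \<or> (y, x) \<in> r"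

lemma comparable_sym: "comparable x y \<Longrightarrow> comparable y x"
  by (auto simp: comparable_def)

text \<open>It suffices to test extensions by a single element, since a larger chain supplies an
  element comparable to all of \<open>C\<close>. As \<open>r\<close> is reflexive on
  \<open>S\<close>, the reflexive closure in the library notion of chain changes nothing.\<close>

lemma max_chains_iff:
  assumes "S \<subseteq> P"
  shows "C \<in> max_chains S r \<longleftrightarrow> C \<subseteq> S \<and> (\<forall>x\<in>C. \<forall>y\<in>C. comparable x y) \<and>
           (\<forall>w\<in>S. (\<forall>x\<in>C. comparable w x) \<longrightarrow> w \<in> C)"
    (is "?L \<longleftrightarrow> ?R")
proof -
  have chain: "pred_on.chain S (\<lambda>x y. (x, y) \<in> r) D \<longleftrightarrow>
      D \<subseteq> S \<and> (\<forall>x\<in>D. \<forall>y\<in>D. comparable x y)" for D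
  proof -
    have "(\<lambda>x y. (x, y) \<in> r)\<^sup>=\<^sup>= x y \<longleftrightarrow> (x, y) \<in> r" if "x \<in> D" "D \<subseteq> S" for x y
      using that assms le_refl[of x] by auto
    then show ?thesis
      unfolding pred_on.chain_def comparable_def by (metis (no_types, lifting))
  qed
  show ?thesis
  proof
    assume L: ?L
    then have C: "C \<subseteq> S" "\<forall>x\<in>C. \<forall>y\<in>C. comparable x y"
      by (auto simp: max_chains_def pred_on.maxchain_def chain)
    have "w \<in> C" if "w \<in> S" "\<forall>x\<in>C. comparable w x" for w
    proof (rule ccontr)
      assume "w \<notin> C"
      moreover have "pred_on.chain S (\<lambda>x y. (x, y) \<in> r) (insert w C)"
        using C that assms le_refl unfolding chain by (auto simp: comparable_def)
      ultimately show False
        using L by (auto simp: max_chains_def pred_on.maxchain_def)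
    qed
    with C show ?R by blast
  next
    assume R: ?R
    then have "\<not> (pred_on.chain S (\<lambda>x y. (x, y) \<in> r) D \<and> C \<subset> D)" for D
      unfolding chain by blast
    with R show ?L
      by (auto simp: max_chains_def pred_on.maxchain_def chain)
  qed
qed

lemma max_chain_subset: "S \<subseteq> P \<Longrightarrow> C \<in> max_chains S r \<Longrightarrow> C \<subseteq> S"
  by (simp add: max_chains_iff)

lemma max_chain_comparable:
  "S \<subseteq> P \<Longrightarrow> C \<in> max_chains S r \<Longrightarrow> x \<in> C \<Longrightarrow> y \<in> C \<Longrightarrow> comparable x y"
  by (simp add: max_chains_iff)

lemma max_chain_absorbs:
  "S \<subseteq> P \<Longrightarrow> C \<in> max_chains S r \<Longrightarrow> w \<in> S \<Longrightarrow> (\<And>x. x \<in> C \<Longrightarrow> comparable w x) \<Longrightarrow> w \<in> C"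
  by (simp add: max_chains_iff)

lemma max_chain_finite: "S \<subseteq> P \<Longrightarrow> C \<in> max_chains S r \<Longrightarrow> finite C"
  using max_chain_subset finite_carrier by (metis finite_subset)

lemma chain_extends_to_max_chain:
  assumes "S \<subseteq> P" "C \<subseteq> S" "\<And>x y. x \<in> C \<Longrightarrow> y \<in> C \<Longrightarrow> comparable x y"
  obtains M where "M \<in> max_chains S r" "C \<subseteq> M"
proof -
  define K where "K = {D. C \<subseteq> D \<and> D \<subseteq> S \<and> (\<forall>x\<in>D. \<forall>y\<in>D. comparable x y)}"
  have "finite S" using assms(1) finite_carrier by (rule finite_subset)
  then have "finite K"
    unfolding K_def by (auto intro: finite_subset[of _ "Pow S"])
  moreover have "C \<in> K" using assms(2,3) by (auto simp: K_def)
  ultimately obtain M where M: "M \<in> K" "C \<subseteq> M" "\<And>D. D \<in> K \<Longrightarrow> M \<subseteq> D \<Longrightarrow> M = D"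
    using finite_has_maximal2[of K C] by metis
  have "w \<in> M" if "w \<in> S" "\<forall>x\<in>M. comparable w x" for w
  proof -
    have "comparable w w" using that(1) assms(1) le_refl by (auto simp: comparable_def)
    then have "insert w M \<in> K"
      using that M(1) comparable_sym by (auto simp: K_def)
    then show ?thesis using M(3) by blast
  qed
  then have "M \<in> max_chains S r"
    using M(1) by (auto simp: K_def max_chains_iff[OF assms(1)])
  with M(2) show ?thesis using that by blast
qed

text \<open>Any maximal chain containing \<open>C\<close> has by gradedness the same size as
  \<open>C\<close>, hence equals \<open>C\<close>. This is how gradedness enters: swapping one
  element of a maximal chain keeps it maximal as long as it stays a chain.\<close>

lemma graded_chain_is_max:
  assumes "graded P r" "c \<in> max_chains P r" "C \<subseteq> P" "card C = card c"
    and "\<And>x y. x \<in> C \<Longrightarrow> y \<in> C \<Longrightarrow> comparable x y"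
  shows "C \<in> max_chains P r"
proof -
  obtain M where M: "M \<in> max_chains P r" "C \<subseteq> M"
    using chain_extends_to_max_chain[of P C] assms(3,5) by blast
  then have "card M = card C"
    using assms(1,2,4) by (metis graded_def)
  then show ?thesis
    using M max_chain_finite[of P M] card_subset_eq[of M C] by auto
qed

text \<open>An element strictly between \<open>x\<close> and \<open>m\<close> would be comparable to
  all of \<open>C\<close>, hence lie in \<open>C\<close>, against \<open>gap\<close>.\<close>

lemma covers_max_chain_successor:
  assumes "S \<subseteq> P" "C \<in> max_chains S r" "x \<in> C" "m \<in> C" "(x, m) \<in> r" "x \<noteq> m"
    and gap: "\<And>y. y \<in> C \<Longrightarrow> (y, x) \<in> r \<or> (m, y) \<in> r"
  shows "covers S r m x"
proof -
  have False if w: "w \<in> S" "(x, w) \<in> r" "(w, m) \<in> r" "w \<noteq> x" "w \<noteq> m" for w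
  proof -
    have "comparable w y" if "y \<in> C" for y
      using gap[OF that] w le_trans unfolding comparable_def by blast
    then have "w \<in> C" using max_chain_absorbs assms(1,2) w(1) by blast
    then show False using gap w le_antisym by blast
  qed
  then show ?thesis
    using assms(1-6) max_chain_subset unfolding covers_def by blast
qed

text \<open>The successor is the least element of \<open>C\<close> strictly above \<open>x\<close>;
  by maximality of \<open>C\<close> it covers \<open>x\<close> in \<open>S\<close>.\<close>

lemma max_chain_succ_exists:
  assumes "S \<subseteq> P" "C \<in> max_chains S r" "x \<in> C" "y \<in> C" "(x, y) \<in> r" "x \<noteq> y"
  obtains m where "m \<in> C" "covers S r m x" "(m, y) \<in> r" "\<And>w. w \<in> C \<Longrightarrow> (w, x) \<in> r \<or> (m, w) \<in> r"
proof -
  define D where "D = {w \<in> C. (x, w) \<in> r \<and> x \<noteq> w}"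
  have total: "(v, w) \<in> r \<or> (w, v) \<in> r" if "v \<in> C" "w \<in> C" for v w
    using max_chain_comparable[OF assms(1,2) that] by (simp add: comparable_def)
  have "finite D" "D \<noteq> {}"
    using max_chain_finite[OF assms(1,2)] assms(4-6) by (auto simp: D_def)
  then obtain m where m: "m \<in> D" "\<And>w. w \<in> D \<Longrightarrow> (m, w) \<in> r"
    using finite_chain_has_least[of D r] trans_le total unfolding D_def by (metis (lifting) mem_Collect_eq)
  have gap: "(w, x) \<in> r \<or> (m, w) \<in> r" if "w \<in> C" for w
    using m(2)[of w] total[OF that assms(3)] that assms(1,3) total by (auto simp: D_def)
  have "covers S r m x"
    using covers_max_chain_successor[OF assms(1-3)] m(1) gap by (auto simp: D_def)
  moreover have "(m, y) \<in> r" using m(2) assms(4-6) by (auto simp: D_def)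
  ultimately show ?thesis using that m(1) gap by (auto simp: D_def)
qed

lemma atom_below:
  assumes "S \<subseteq> P" "is_minimum S r z" "x \<in> S" "x \<noteq> z"
  obtains a where "a \<in> atoms S r z" "(a, x) \<in> r"
proof -
  have z: "z \<in> S" "(z, x) \<in> r" using assms(2,3) by (auto simp: is_minimum_def)
  then obtain C where "C \<in> max_chains S r" "{z, x} \<subseteq> C"
    using chain_extends_to_max_chain[of S "{z, x}"] assms(1,3) le_refl
    by (auto simp: comparable_def subset_iff)
  then obtain m where "covers S r m z" "(m, x) \<in> r"
    using max_chain_succ_exists[OF assms(1), of C z x] assms(4) z(2) by auto
  then show ?thesis using that by (auto simp: atoms_def)
qed

text \<open>Every element of a chain through \<open>a\<close>, and every candidate for extending it,
  is comparable to \<open>a\<close>; so only that part of the carrier matters.\<close>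

lemma max_chains_local_cong:
  assumes "S \<subseteq> P" "T \<subseteq> P" "a \<in> c"
    and "\<And>x. comparable x a \<Longrightarrow> x \<in> S \<longleftrightarrow> x \<in> T"
  shows "c \<in> max_chains S r \<longleftrightarrow> c \<in> max_chains T r"
  unfolding max_chains_iff[OF assms(1)] max_chains_iff[OF assms(2)]
  using assms(3,4) by blast

end

section \<open>Atoms, atom spans and the chains through a fixed atom\<close>

locale finite_poset_with_min = finite_poset +
  fixes z
  assumes minimum: "is_minimum P r z"
begin

lemma min_in: "z \<in> P" and min_le: "x \<in> P \<Longrightarrow> (z, x) \<in> r"
  using minimum by (auto simp: is_minimum_def)

lemma atomsD:
  assumes "a \<in> atoms P r z"
  shows "a \<in> P" "a \<noteq> z" "x \<in> P \<Longrightarrow> (x, a) \<in> r \<Longrightarrow> x = z \<or> x = a"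
  using assms min_le by (auto simp: atoms_def covers_def)

lemma comparable_atoms_eq:
  assumes "a \<in> atoms P r z" "b \<in> atoms P r z" "comparable a b"
  shows "a = b"
  using assms atomsD by (metis comparable_def)

lemma atom_span_subset: "atom_span P r z B \<subseteq> P"
  using min_in by (auto simp: atom_span_def)

lemma atoms_subset_atom_span: "B \<subseteq> atoms P r z \<Longrightarrow> B \<subseteq> atoms (atom_span P r z B) r z"
  using min_in atom_span_subset le_refl unfolding atoms_def covers_def atom_span_def by blast

lemma min_in_max_chain: "z \<in> S \<Longrightarrow> S \<subseteq> P \<Longrightarrow> c \<in> max_chains S r \<Longrightarrow> z \<in> c"
  using max_chain_absorbs[of S c z] max_chain_subset min_le by (auto simp: comparable_def)

text \<open>Elements above \<open>a\<close> belong to the span by definition, and the only elements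
  of \<open>P\<close> below \<open>a\<close> are \<open>z\<close> and \<open>a\<close>.\<close>

lemma comparable_atom_span:
  assumes "B \<subseteq> atoms P r z" "a \<in> B" "comparable x a"
  shows "x \<in> atom_span P r z B \<longleftrightarrow> x \<in> P"
  using assms atomsD[of a] min_in unfolding comparable_def atom_span_def by blast

lemma max_chains_atom_span_iff:
  assumes "B \<subseteq> atoms P r z" "a \<in> B" "a \<in> c"
  shows "c \<in> max_chains (atom_span P r z B) r \<longleftrightarrow> c \<in> max_chains P r"
  using max_chains_local_cong[OF atom_span_subset subset_refl assms(3)]
    comparable_atom_span[OF assms(1,2)] by blast

text \<open>The successor \<open>m\<close> of \<open>z\<close> on \<open>c\<close> lies above some
  \<open>a\<close> in \<open>B\<close>; since \<open>m\<close> covers \<open>z\<close> in the span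
  and \<open>a\<close> is in the span, \<open>a = m\<close>. Nonemptiness of \<open>B\<close>
  excludes \<open>c = {z}\<close>.\<close>

lemma max_chain_atom_span_atom:
  assumes B: "B \<subseteq> atoms P r z" "B \<noteq> {}" and c: "c \<in> max_chains (atom_span P r z B) r"
  obtains a where "a \<in> B" "a \<in> c"
proof -
  let ?T = "atom_span P r z B"
  note T = atom_span_subset[of B]
  have zc: "z \<in> c" using min_in_max_chain[OF _ T c] by (simp add: atom_span_def)
  obtain b where b: "b \<in> B" using B(2) by blast
  then have "b \<in> ?T" "b \<noteq> z" using B(1) atomsD le_refl unfolding atom_span_def by blast+
  have "c \<noteq> {z}"
  proof
    assume "c = {z}"
    then have "b \<in> c"
      using max_chain_absorbs[OF T c \<open>b \<in> ?T\<close>] min_le \<open>b \<in> ?T\<close> T by (auto simp: comparable_def)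
    then show False using \<open>c = {z}\<close> \<open>b \<noteq> z\<close> by simp
  qed
  then obtain y where "y \<in> c" "y \<noteq> z" using zc by blast
  moreover have "y \<in> P" using \<open>y \<in> c\<close> max_chain_subset[OF T c] T by blast
  ultimately obtain m where m: "m \<in> c" "covers ?T r m z"
      "\<And>w. w \<in> c \<Longrightarrow> (w, z) \<in> r \<or> (m, w) \<in> r"
    using max_chain_succ_exists[OF T c zc] min_le by metis
  then obtain a where a: "a \<in> B" "(a, m) \<in> r"
    unfolding covers_def atom_span_def by blast
  then have "a \<in> ?T" "a \<noteq> z" using B(1) atomsD le_refl unfolding atom_span_def by blast+
  then have "a = m"
    using a(2) m(2) min_le T unfolding covers_def by blast
  then show ?thesis using that a(1) m(1) by blast
qed

text \<open>Apart from \<open>z\<close>, everything comparable to the atom \<open>a\<close> lies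
  above it, so a maximal chain through \<open>a\<close> is a maximal chain of \<open>I\<close> with
  \<open>z\<close> added.\<close>

lemma max_chains_upper_interval:
  assumes "a \<in> atoms P r z" "I = {x \<in> P. (a, x) \<in> r}"
  shows "{c \<in> max_chains P r. a \<in> c} = insert z ` max_chains I r"
proof -
  have I: "I \<subseteq> P" "a \<in> I" "z \<notin> I"
    using assms atomsD[OF assms(1)] le_refl min_in le_antisym min_le by blast+
  have P: "x = z \<or> x \<in> I" if "x \<in> P" "comparable x a" for x
    using that assms(2) atomsD[OF assms(1)] le_refl unfolding comparable_def by blast
  show ?thesis
  proof (intro equalityI subsetI)
    fix c assume "c \<in> {c \<in> max_chains P r. a \<in> c}"
    then have c: "c \<in> max_chains P r" "a \<in> c" by auto
    have zc: "z \<in> c" using min_in_max_chain[OF min_in subset_refl c(1)] .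
    have "c - {z} \<subseteq> I"
      using P max_chain_subset[OF subset_refl c(1)] max_chain_comparable[OF subset_refl c(1) _ c(2)]
      by blast
    moreover have "w \<in> c - {z}" if "w \<in> I" "\<forall>x\<in>c - {z}. comparable w x" for w
    proof -
      have "comparable w z" using that(1) I(1) min_le by (auto simp: comparable_def)
      then have "w \<in> c" using max_chain_absorbs[OF subset_refl c(1), of w] that I(1) by blast
      then show ?thesis using that(1) I(3) by blast
    qed
    ultimately have "c - {z} \<in> max_chains I r"
      using max_chain_comparable[OF subset_refl c(1)] by (auto simp: max_chains_iff[OF I(1)])
    then show "c \<in> insert z ` max_chains I r"
      using zc by (metis image_eqI insert_Diff)
  next
    fix c assume "c \<in> insert z ` max_chains I r"
    then obtain d where d: "d \<in> max_chains I r" and c: "c = insert z d" by blast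
    note dI = max_chain_subset[OF I(1) d]
    have ad: "a \<in> d"
      using max_chain_absorbs[OF I(1) d I(2)] dI assms(2) by (auto simp: comparable_def)
    have "comparable x y" if "x \<in> c" "y \<in> c" for x y
      using that max_chain_comparable[OF I(1) d] dI I(1) min_le min_in
      unfolding c comparable_def by blast
    moreover have "w \<in> c" if "w \<in> P" "\<forall>x\<in>c. comparable w x" for w
      using P[OF that(1)] that(2) ad max_chain_absorbs[OF I(1) d] unfolding c by blast
    moreover have "c \<subseteq> P" "a \<in> c"
      using dI I(1) min_in ad unfolding c by blast+
    ultimately show "c \<in> {c \<in> max_chains P r. a \<in> c}"
      unfolding max_chains_iff[OF subset_refl] by blast
  qed
qed

end

section \<open>Shelling the span of \<open>insert ap A\<close>\<close>

theorem theorem3: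
  fixes P :: "'a set" and r :: "'a rel" and zero_hat one_hat :: 'a
    and A :: "'a set" and s :: "'a rel" and ap :: 'a
    and Q I Aall Aint :: "'a set"
  assumes fin: "finite P"
    and po: "partial_order_on P r"
    and graded: "graded P r"
    and zero_hat: "is_minimum P r zero_hat"
    and one_hat: "is_maximum P r one_hat"
    and A_atoms: "A \<subseteq> atoms P r zero_hat"
    and A_po: "partial_order_on A s"
    and ap_atom: "ap \<in> atoms P r zero_hat"
    and ap_new: "ap \<notin> A"
    and Q: "Q = atom_span P r zero_hat (insert ap A) - atom_span P r zero_hat A"
    and I: "I = interval P r ap one_hat"
    and Aall: "Aall = atoms I r ap"
    and Aint: "Aint = Aall \<inter> atom_span P r zero_hat A"
    and i: "B_shellable P r zero_hat A s"
    and ii: "\<exists>l. linear_order_on Aall l \<and>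
               (\<forall>x\<in>Aint. \<forall>y\<in>Aall - Aint. strictly_before l x y) \<and>
               B_shellable I r ap Aall l"
    and iii: "\<forall>q\<in>Q. \<forall>p\<in>atom_span P r zero_hat A. covers P r p q \<longrightarrow> p \<in> atom_span I r ap Aint"
  shows "B_shellable P r zero_hat (insert ap A) (adjoin_greatest A s ap)"
proof -
  interpret finite_poset_with_min P r zero_hat
    using fin po zero_hat by unfold_locales
  let ?z = zero_hat
  let ?S = "atom_span P r ?z A" and ?T = "atom_span P r ?z (insert ap A)"
  have T_atoms: "insert ap A \<subseteq> atoms P r ?z" using A_atoms ap_atom by blast
  note ap = atomsD[OF ap_atom]
  have I_eq: "I = {x \<in> P. (ap, x) \<in> r}"
    using one_hat unfolding I interval_def is_maximum_def by blast
  have I_sub: "I \<subseteq> P" and ap_I: "ap \<in> I" and z_I: "?z \<notin> I"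
    using I_eq ap le_refl le_antisym min_le min_in by blast+
  have I_min: "is_minimum I r ap" using ap_I I_eq by (auto simp: is_minimum_def)
  \<comment> \<open>Makes the order supplied by (ii) a shelling order of \<open>I\<close>
    itself.\<close>
  have span_I: "atom_span I r ap Aall = I"
  proof -
    have "x \<in> atom_span I r ap Aall" if "x \<in> I" for x
      using atom_below[OF I_sub I_min that] that unfolding atom_span_def Aall by blast
    then show ?thesis using ap_I unfolding atom_span_def by blast
  qed
  \<comment> \<open>Membership would put \<open>ap\<close> above an atom in \<open>A\<close>, but
    distinct atoms are incomparable.\<close>
  have ap_S: "ap \<notin> ?S"
    using ap(2) comparable_atoms_eq[OF _ ap_atom] A_atoms ap_new
    unfolding atom_span_def comparable_def by blast

  obtain L1 where L1: "shelling_order ?S r L1"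
    and L1_atoms: "\<And>c c' a a'. c \<in> max_chains ?S r \<Longrightarrow> c' \<in> max_chains ?S r \<Longrightarrow>
      a \<in> c \<inter> atoms ?S r ?z \<Longrightarrow> a' \<in> c' \<inter> atoms ?S r ?z \<Longrightarrow> strictly_before s a' a \<Longrightarrow>
      strictly_before L1 c' c"
    using i unfolding B_shellable_def Let_def by blast
  obtain l L2 where l: "\<And>x y. x \<in> Aint \<Longrightarrow> y \<in> Aall - Aint \<Longrightarrow> strictly_before l x y"
    and L2: "shelling_order I r L2"
    and L2_atoms: "\<And>c c' a a'. c \<in> max_chains I r \<Longrightarrow> c' \<in> max_chains I r \<Longrightarrow>
      a \<in> c \<inter> atoms I r ap \<Longrightarrow> a' \<in> c' \<inter> atoms I r ap \<Longrightarrow> strictly_before l a' a \<Longrightarrow>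
      strictly_before L2 c' c"
    using ii unfolding B_shellable_def Let_def span_I by blast

  define X where "X = {c \<in> max_chains ?T r. ap \<notin> c}"
  define Y where "Y = insert ?z ` max_chains I r"
  have Y_eq: "Y = {c \<in> max_chains P r. ap \<in> c}"
    unfolding Y_def using max_chains_upper_interval[OF ap_atom I_eq] by simp
  have XY: "max_chains ?T r = X \<union> Y" "X \<inter> Y = {}"
    using max_chains_atom_span_iff[OF T_atoms, of ap] unfolding X_def Y_eq by auto
  \<comment> \<open>Equality can fail: for empty \<open>A\<close>, \<open>?S\<close> is
    \<open>{?z}\<close>, whose one maximal chain \<open>{?z}\<close> is not maximal in
    \<open>?T\<close>, and \<open>X\<close> is empty. For nonempty \<open>A\<close> the converse
    inclusion is \<open>S_sub\<close>.\<close>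
  have X_sub: "X \<subseteq> max_chains ?S r" and X_ne: "X \<noteq> {} \<Longrightarrow> A \<noteq> {}"
  proof -
    have *: "\<exists>a\<in>A. a \<in> c" "c \<in> max_chains ?S r" if "c \<in> X" for c
    proof -
      have c: "c \<in> max_chains ?T r" "ap \<notin> c" using that by (auto simp: X_def)
      obtain a where "a \<in> insert ap A" "a \<in> c"
        using max_chain_atom_span_atom[OF T_atoms _ c(1)] by blast
      then show "\<exists>a\<in>A. a \<in> c" "c \<in> max_chains ?S r"
        using c max_chains_atom_span_iff[OF T_atoms, of a] max_chains_atom_span_iff[OF A_atoms, of a]
        by auto
    qed
    show "X \<subseteq> max_chains ?S r" "X \<noteq> {} \<Longrightarrow> A \<noteq> {}" using * by blast+
  qed
  have S_sub: "c \<in> X" if c: "c \<in> max_chains ?S r" and A_ne: "A \<noteq> {}" for c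
  proof -
    obtain a where "a \<in> A" "a \<in> c"
      using max_chain_atom_span_atom[OF A_atoms A_ne c] by blast
    moreover have "ap \<notin> c"
      using max_chain_subset[OF atom_span_subset c] ap_S by blast
    ultimately show ?thesis
      using c max_chains_atom_span_iff[OF T_atoms, of a] max_chains_atom_span_iff[OF A_atoms, of a]
      by (auto simp: X_def)
  qed
  have X_I: "c \<in> X" if "c \<in> max_chains P r" "a \<in> A" "a \<in> c" for c a
    using that S_sub[of c] max_chains_atom_span_iff[OF A_atoms, of a c] by blast
  have inj: "inj_on (insert ?z) (max_chains I r)"
    using z_I max_chain_subset[OF I_sub] by (intro inj_onI) (metis insert_ident subsetD)

  \<comment> \<open>The ordinal sum of the order from (i) on \<open>X\<close> and the order from
    (ii), carried to \<open>Y\<close> by \<open>insert ?z\<close>. Restricting \<open>L1\<close>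
    discards the chain \<open>{?z}\<close> when \<open>A\<close> is empty.\<close>
  define L where "L = Restr L1 X \<union> map_prod (insert ?z) (insert ?z) ` L2 \<union> X \<times> Y"
  have L_lin: "linear_order_on (max_chains ?T r) L"
    unfolding L_def XY(1)
    using L1 L2 XY(2) X_sub inj unfolding shelling_order_def Y_def
    by (intro linear_order_on_ordinal_sum linear_order_on_Restr linear_order_on_image) auto
  have L2_sub: "L2 \<subseteq> max_chains I r \<times> max_chains I r"
    using L2 unfolding shelling_order_def order_on_defs by blast
  have L_X: "strictly_before L c' c \<longleftrightarrow> c' \<in> X \<and> strictly_before L1 c' c" if "c \<in> X" for c c'
    using that XY(2) L2_sub unfolding L_def strictly_before_def Y_def by auto
  have L_XY: "strictly_before L c' c" if "c' \<in> X" "c \<in> Y" for c c'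
    using that XY(2) unfolding L_def strictly_before_def by blast
  have L_Y: "strictly_before L (insert ?z d') (insert ?z d) \<longleftrightarrow> strictly_before L2 d' d"
    if "d \<in> max_chains I r" "d' \<in> max_chains I r" for d d'
  proof -
    have "insert ?z d \<notin> X" "insert ?z d' \<notin> X"
      using that XY(2) unfolding Y_def by blast+
    then have "(insert ?z d', insert ?z d) \<in> L \<longleftrightarrow> (d', d) \<in> L2"
      unfolding L_def Un_iff Int_iff mem_Sigma_iff map_prod_image_iff[OF inj L2_sub that(2,1)]
      by simp
    then show ?thesis
      unfolding strictly_before_def inj_on_eq_iff[OF inj that(2,1)] by simp
  qed

  \<comment> \<open>The chain \<open>c'\<close> need not pass through \<open>ap\<close>: any
    \<open>d'\<close> before \<open>d\<close> that contains \<open>d \<inter> c'\<close> can stand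
    in for it. This covers both \<open>c'\<close> in \<open>Y\<close> and the case where
    \<open>c'\<close> in \<open>X\<close> is replaced by a detour inside \<open>I\<close>.\<close>
  have L2_step: "\<exists>cs\<in>max_chains ?T r. strictly_before L cs (insert ?z d) \<and>
      insert ?z d \<inter> c' \<subseteq> insert ?z d \<inter> cs \<and> card (sym_diff (insert ?z d) cs) = 2"
    if d: "d \<in> max_chains I r" "d' \<in> max_chains I r" "strictly_before L2 d' d"
      and c': "d \<inter> c' \<subseteq> d'" for d d' c'
  proof -
    obtain ds where ds: "ds \<in> max_chains I r" "strictly_before L2 ds d" "d \<inter> d' \<subseteq> d \<inter> ds"
        "card (sym_diff d ds) = 2"
      using L2 d unfolding shelling_order_def by blast
    have "sym_diff (insert ?z d) (insert ?z ds) = sym_diff d ds"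
      using z_I max_chain_subset[OF I_sub] d(1) ds(1) by blast
    then have "card (sym_diff (insert ?z d) (insert ?z ds)) = 2"
      using ds(4) by simp
    moreover have "insert ?z ds \<in> max_chains ?T r"
      using ds(1) XY(1) unfolding Y_def by blast
    ultimately show ?thesis
      using ds(2,3) c' L_Y[OF d(1) ds(1)] by (intro bexI[of _ "insert ?z ds"]) auto
  qed

  have "shelling_order ?T r L"
    unfolding shelling_order_def
  proof (intro conjI ballI impI)
    show "linear_order_on (max_chains ?T r) L" by (rule L_lin)
  next
    fix c c'
    assume c: "c \<in> max_chains ?T r" and c': "c' \<in> max_chains ?T r"
      and before: "strictly_before L c' c"
    show "\<exists>cs\<in>max_chains ?T r. strictly_before L cs c \<and> c \<inter> c' \<subseteq> c \<inter> cs \<and> card (sym_diff c cs) = 2"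
    proof (cases "c \<in> X")
      case True
      then have "c' \<in> X" "strictly_before L1 c' c" using L_X before by blast+
      then obtain cs where "cs \<in> max_chains ?S r" "strictly_before L1 cs c" "c \<inter> c' \<subseteq> c \<inter> cs"
          "card (sym_diff c cs) = 2"
        using L1 X_sub True unfolding shelling_order_def by blast
      moreover from this have "cs \<in> X" using S_sub X_ne True by blast
      ultimately show ?thesis using L_X[OF True] XY(1) by blast
    next
      case False
      then obtain d where d: "d \<in> max_chains I r" and c_eq: "c = insert ?z d"
        using c XY(1) unfolding Y_def by blast
      have cY: "c \<in> Y" using d c_eq unfolding Y_def by blast
      then have cP: "c \<in> max_chains P r" and ap_c: "ap \<in> c" unfolding Y_eq by auto
      have dI: "d \<subseteq> I" using max_chain_subset[OF I_sub d] .
      have ap_d: "ap \<in> d" using ap_c ap(2) c_eq by blast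
      show ?thesis
      proof (cases "c' \<in> X")
        case False
        then obtain d' where d': "d' \<in> max_chains I r" and c'_eq: "c' = insert ?z d'"
          using c' XY(1) unfolding Y_def by blast
        have "strictly_before L2 d' d" using before L_Y[OF d d'] unfolding c_eq c'_eq by blast
        moreover have "d \<inter> c' \<subseteq> d'" using dI z_I unfolding c'_eq by blast
        ultimately show ?thesis using L2_step[OF d d'] unfolding c_eq by blast
      next
        case c'X: True
        then have "A \<noteq> {}" using X_ne by blast
        then obtain a0 where a0: "a0 \<in> A" by blast
        have c'S: "c' \<subseteq> ?S" using c'X X_sub max_chain_subset[OF atom_span_subset] by blast
        have top: "one_hat \<in> c"
          using max_chain_absorbs[OF subset_refl cP, of one_hat] one_hat max_chain_subset[OF subset_refl cP]
          unfolding is_maximum_def comparable_def by blast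
        \<comment> \<open>Guarantees that \<open>c\<close> meets \<open>?S\<close> above
          \<open>ap\<close>, so that a least such element \<open>p\<close> can be chosen
          below.\<close>
        have top_S: "one_hat \<in> ?S"
          using a0 A_atoms atomsD(1) one_hat unfolding atom_span_def is_maximum_def by blast
        have top_d: "one_hat \<in> d"
          using top ap one_hat min_le le_antisym unfolding c_eq is_maximum_def by blast
        have "ap \<noteq> one_hat" using top_S ap_S by blast
        moreover have "(ap, one_hat) \<in> r" using ap(1) one_hat by (auto simp: is_maximum_def)
        ultimately obtain x2 where x2: "x2 \<in> d" "covers I r x2 ap"
            "\<And>w. w \<in> d \<Longrightarrow> (w, ap) \<in> r \<or> (x2, w) \<in> r"
          using max_chain_succ_exists[OF I_sub d ap_d top_d] by blast
        then have x2_all: "x2 \<in> Aall" by (simp add: Aall atoms_def)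
        have gap: "w = ap \<or> (x2, w) \<in> r" if "w \<in> d" for w
          using x2(3)[OF that] that dI ap(3)[of w] I_sub z_I by blast
        show ?thesis
        proof (cases "x2 \<in> ?S")
          case True
          then obtain a where a: "a \<in> A" "(a, x2) \<in> r"
            using x2(1) dI z_I unfolding atom_span_def by blast
          have aP: "a \<in> P" "a \<in> atoms P r ?z" using a(1) A_atoms atomsD by blast+
          have "a \<notin> c"
            using max_chain_comparable[OF subset_refl cP ap_c, of a] comparable_atoms_eq[OF ap_atom aP(2)]
              a(1) ap_new by blast
          \<comment> \<open>Every element of \<open>c\<close> other than \<open>?z\<close> and
            \<open>ap\<close> lies above \<open>x2\<close>, hence above \<open>a\<close>, so the
            exchange leaves a chain of the same size.\<close>
          define cs where "cs = insert a (c - {ap})"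
          have "card cs = card c"
            using \<open>a \<notin> c\<close> max_chain_finite[OF subset_refl cP]
              card_Suc_Diff1[OF max_chain_finite[OF subset_refl cP] ap_c]
            unfolding cs_def by simp
          moreover have "comparable a y" if "y \<in> c - {ap}" for y
            using that gap[of y] a(2) le_trans[of a x2 y] min_le[OF aP(1)]
            unfolding c_eq comparable_def by blast
          then have "comparable x y" if "x \<in> cs" "y \<in> cs" for x y
            using that max_chain_comparable[OF subset_refl cP] comparable_sym le_refl[OF aP(1)]
            unfolding cs_def comparable_def by blast
          ultimately have "cs \<in> max_chains P r"
            using graded_chain_is_max[OF graded cP, of cs] aP(1) max_chain_subset[OF subset_refl cP]
            unfolding cs_def by blast
          then have "cs \<in> X" using X_I a(1) unfolding cs_def by blast
          moreover have "sym_diff c cs = {a, ap}"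
            using \<open>a \<notin> c\<close> ap_c unfolding cs_def by blast
          moreover have "a \<noteq> ap" using a(1) ap_new by blast
          ultimately have "cs \<in> X" "card (sym_diff c cs) = 2" by simp_all
          \<comment> \<open>The only element of \<open>c\<close> given up is \<open>ap\<close>,
            which is not on \<open>c'\<close>.\<close>
          moreover have "c \<inter> c' \<subseteq> c \<inter> cs" using c'S ap_S unfolding cs_def by blast
          ultimately show ?thesis using L_XY cY XY(1) by blast
        next
          case x2_S: False
          have total: "(v, w) \<in> r \<or> (w, v) \<in> r" if "v \<in> d" "w \<in> d" for v w
            using max_chain_comparable[OF I_sub d that] by (simp add: comparable_def)
          have "finite d" using max_chain_finite[OF I_sub d] .
          obtain p where p: "p \<in> d \<inter> ?S" "\<And>w. w \<in> d \<inter> ?S \<Longrightarrow> (p, w) \<in> r"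
            using finite_chain_has_least[of "d \<inter> ?S" r] \<open>finite d\<close> top_d top_S trans_le total
            by (metis Int_iff empty_iff finite_Int)
          then have "p \<in> P" "(ap, p) \<in> r" "p \<noteq> ap" using dI I_eq ap_S by auto
          \<comment> \<open>Its greatest element \<open>q\<close> is the predecessor of
            \<open>p\<close> on \<open>c\<close>. By minimality of \<open>p\<close> it is outside
            \<open>?S\<close>, hence in \<open>Q\<close>, and (iii) applies to the pair
            \<open>q\<close>, \<open>p\<close>.\<close>
          define D where "D = {w \<in> d. (w, p) \<in> r \<and> w \<noteq> p}"
          obtain q where q: "q \<in> D" "\<And>w. w \<in> D \<Longrightarrow> (w, q) \<in> r"
          proof (rule finite_chain_has_greatest[of D r])
            show "finite D" using \<open>finite d\<close> by (simp add: D_def)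
            show "D \<noteq> {}" using \<open>(ap, p) \<in> r\<close> \<open>p \<noteq> ap\<close> ap_d by (auto simp: D_def)
            show "trans r" by (rule trans_le)
            show "(x, y) \<in> r \<or> (y, x) \<in> r" if "x \<in> D" "y \<in> D" for x y
              using that total by (simp add: D_def)
          qed blast
          have q': "q \<in> d" "(q, p) \<in> r" "q \<noteq> p" using q(1) by (auto simp: D_def)
          have "q \<notin> ?S" using p(2)[of q] q' le_antisym by blast
          moreover have "q \<in> ?T" using q'(1) dI I_eq unfolding atom_span_def by blast
          ultimately have "q \<in> Q" using Q by blast
          moreover have "covers P r p q"
          proof (rule covers_max_chain_successor[OF subset_refl cP])
            show "(y, q) \<in> r \<or> (p, y) \<in> r" if "y \<in> c" for y
              using that q(2)[of y] total[of y p] p(1) min_le q'(1) dI I_sub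
              unfolding D_def c_eq by blast
          qed (use q' p c_eq in auto)
          ultimately have "p \<in> atom_span I r ap Aint" using iii p(1) by blast
          then obtain b where b: "b \<in> Aint" "(b, p) \<in> r"
            using \<open>p \<noteq> ap\<close> unfolding atom_span_def by blast
          have bI: "b \<in> I" and b_all: "b \<in> Aall" using b(1) unfolding Aint Aall atoms_def covers_def by auto
          \<comment> \<open>The part of \<open>d\<close> strictly between \<open>ap\<close> and
            \<open>p\<close> is replaced by \<open>b\<close>; an extension \<open>d'\<close> then
            has \<open>b\<close> as its atom in \<open>I\<close>.\<close>
          define D' where "D' = {ap, b} \<union> {y \<in> d. (p, y) \<in> r}"
          have "D' \<subseteq> I" using ap_I bI dI unfolding D'_def by blast
          moreover have "comparable x y" if "x \<in> D'" "y \<in> D'" for x y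
          proof -
            have le: "(ap, w) \<in> r" if "w \<in> D'" for w using that \<open>D' \<subseteq> I\<close> I_eq by blast
            have le': "w = ap \<or> (b, w) \<in> r" if "w \<in> D'" for w
              using that b(2) le_trans le_refl bI I_sub unfolding D'_def by blast
            have "x = ap \<or> y = ap \<or> x = b \<or> y = b \<or> x \<in> d \<and> y \<in> d"
              using that unfolding D'_def by blast
            then show ?thesis
              using le le' that total unfolding comparable_def by blast
          qed
          ultimately obtain d' where d': "d' \<in> max_chains I r" "D' \<subseteq> d'"
            using chain_extends_to_max_chain[OF I_sub] by blast
          \<comment> \<open>In the present case \<open>x2\<close> is outside \<open>?S\<close>, so
            it belongs to \<open>Aall - Aint\<close>, which (ii) places after
            \<open>Aint\<close>.\<close>
          have "strictly_before l b x2"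
            using l b(1) x2_all x2_S unfolding Aint by blast
          then have "strictly_before L2 d' d"
            using L2_atoms[OF d d'(1), of x2 b] x2(1) x2_all b_all d'(2)
            unfolding Aall D'_def by blast
          \<comment> \<open>Common elements lie in \<open>?S\<close>, hence above \<open>p\<close>
            by its choice, where \<open>d'\<close> agrees with \<open>d\<close>.\<close>
          moreover have "d \<inter> c' \<subseteq> d'" using c'S p(2) d'(2) unfolding D'_def by blast
          ultimately show ?thesis using L2_step[OF d d'(1)] unfolding c_eq by blast
        qed
      qed
    qed
  qed
  \<comment> \<open>Compatibility with the atom order. As \<open>ap\<close> is greatest, the smaller
    atom \<open>a'\<close> is in \<open>A\<close>, so \<open>c'\<close> is in \<open>X\<close>; then
    \<open>c\<close> is either in \<open>Y\<close>, or in \<open>X\<close> where (i)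
    decides.\<close>
  moreover have "strictly_before L c' c"
    if c: "c \<in> max_chains ?T r" "c' \<in> max_chains ?T r" "a \<in> c" "a' \<in> c'"
      and before: "strictly_before (adjoin_greatest A s ap) a' a" for c c' a a'
  proof -
    have "s \<subseteq> A \<times> A" using A_po by (simp add: order_on_defs)
    then have a': "a' \<in> A" and a: "a = ap \<or> a \<in> A \<and> strictly_before s a' a"
      using before unfolding strictly_before_def adjoin_greatest_def by blast+
    have X: "e \<in> X" if "e \<in> max_chains ?T r" "b \<in> A" "b \<in> e" for e b
      using that X_I max_chains_atom_span_iff[OF T_atoms, of b e] by blast
    have c'X: "c' \<in> X" using X c(2,4) a' by blast
    show ?thesis
    proof (cases "a = ap")
      case True
      then have "c \<in> Y" using c(1,3) XY(1) unfolding X_def by blast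
      then show ?thesis using L_XY c'X by blast
    next
      case False
      then have aA: "a \<in> A" "strictly_before s a' a" using a by blast+
      then have "c \<in> X" using X c(1,3) by blast
      moreover have "strictly_before L1 c' c"
        using L1_atoms[of c c' a a'] X_sub c'X \<open>c \<in> X\<close> c(3,4) aA a'
          atoms_subset_atom_span[OF A_atoms] by blast
      ultimately show ?thesis using L_X c'X by blast
    qed
  qed
  ultimately show ?thesis
    unfolding B_shellable_def Let_def by blast
qed

end
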